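(* Fix any $\varepsilon>0$ and $\delta\in(0,1/20)$, and let $\gamma=\frac12-\sqrt{\frac{h(\delta)\ln 2}{2}}$. Let $\mathcal{C}\subseteq\{0,1\}^n$ be an arbitrary code of rate $$R\geq 1-\delta-(\gamma-\delta)\,h\left(\frac{\delta}{\gamma-\delta}\right)+\varepsilon.$$ Then $\mathcal{C}$ has list size $2^{\Omega(\varepsilon n)}$ from a $\delta$-fraction of deletions; that is, there exists $y\in\{0,1\}^{(1-\delta)n}$ such that $|\{c\in\mathcal{C}: y\preceq c\}|\ge 2^{\Omega(\varepsilon n)}$. In particular, $$C_{\mathrm{del}}(\delta)\leq 1-\delta-(\gamma-\delta)\,h\left(\frac{\delta}{\gamma-\delta}\right)=1-h(\delta)+o(\delta),$$ where $o(\delta)$ is as $\delta\to 0$.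
   Context: $h(p)=-p\log p-(1-p)\log(1-p)$ is the binary entropy function, with $\log$ base $2$; $\ln$ is the natural logarithm. A string $y$ is a subsequence of $c$, written $y\preceq c$, if $y$ is obtained from $c$ by deleting some (possibly none) of its symbols. A code $\mathcal{C}\subseteq\{0,1\}^n$ has rate $R$ if $|\mathcal{C}|=2^{Rn}$. For simplicity $\delta n$ is assumed to be an integer. Asymptotic notation in $n$ is for $n\to\infty$ with $\delta,\varepsilon$ fixed: $2^{\Omega(\varepsilon n)}$ means $2^{c\varepsilon n}$ for an absolute constant $c>0$, for all sufficiently large $n$. A code $\mathcal{C}\subseteq\{0,1\}^n$ is $(\delta,L)$-list-decodable from deletions if for every $y\in\{0,1\}^{(1-\delta)n}$ we have $|\{c\in\mathcal{C}: y\preceq c\}|\le L$. $C_{\mathrm{del}}(\delta)$, the capacity of list-decoding from a $\delta$-fraction of deletions, is the largest real number such that for any rate $R<C_{\mathrm{del}}(\delta)$ and all sufficiently large $n$ there exists a code $\mathcal{C}\subseteq\{0,1\}^n$ of rate at least $R$ that is $(\delta,L)$-list-decodable from deletions with list size $L=L(n)$ growing at most polynomially in $n$. *)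

theory Defs
  imports
    Complex_Main
    "HOL-Library.Sublist"
    "HOL-Library.Landau_Symbols"
begin

definition binary_entropy :: "real \<Rightarrow> real" where
  "binary_entropy p = - p * log 2 p - (1 - p) * log 2 (1 - p)"

definition words :: "nat \<Rightarrow> bool list set" where
  "words n = {w. length w = n}"

text \<open>A relation rather than \<open>log 2 (card C) / n\<close>, so that the empty code has no rate.\<close>

definition has_rate :: "nat \<Rightarrow> bool list set \<Rightarrow> real \<Rightarrow> bool" where
  "has_rate n C R \<longleftrightarrow> real (card C) = 2 powr (R * real n)"

text \<open>Length of a word after a \<open>\<delta>\<close>-fraction of deletions. The number of deletions is
  rounded down; when \<open>\<delta> * n\<close> is an integer the length is exactly \<open>(1 - \<delta>) * n\<close>.
  Without rounding, the capacity below would make no sense for irrational \<open>\<delta>\<close>.\<close>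

definition received_length :: "real \<Rightarrow> nat \<Rightarrow> nat" where
  "received_length \<delta> n = n - nat \<lfloor>\<delta> * real n\<rfloor>"

definition list_at :: "bool list set \<Rightarrow> bool list \<Rightarrow> bool list set" where
  "list_at C y = {c \<in> C. subseq y c}"

definition list_decodable_del :: "nat \<Rightarrow> real \<Rightarrow> nat \<Rightarrow> bool list set \<Rightarrow> bool" where
  "list_decodable_del n \<delta> L C \<longleftrightarrow>
     (\<forall>y \<in> words (received_length \<delta> n). card (list_at C y) \<le> L)"

definition polynomially_bounded :: "(nat \<Rightarrow> nat) \<Rightarrow> bool" where
  "polynomially_bounded L \<longleftrightarrow> (\<exists>k::nat. (\<lambda>n. real (L n)) \<in> O(\<lambda>n. real n ^ k))"

definition achievable_below :: "real \<Rightarrow> real \<Rightarrow> bool" where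
  "achievable_below \<delta> K \<longleftrightarrow>
     (\<forall>R < K. \<exists>L. polynomially_bounded L \<and>
        (\<forall>\<^sub>F n in sequentially. \<exists>C \<subseteq> words n.
           (\<exists>R' \<ge> R. has_rate n C R') \<and> list_decodable_del n \<delta> (L n) C))"

definition C_del :: "real \<Rightarrow> real" where
  "C_del \<delta> = (GREATEST K. achievable_below \<delta> K)"

definition del_gamma :: "real \<Rightarrow> real" where
  "del_gamma \<delta> = 1 / 2 - sqrt (binary_entropy \<delta> * ln 2 / 2)"

definition del_rate_bound :: "real \<Rightarrow> real" where
  "del_rate_bound \<delta> =
     1 - \<delta> - (del_gamma \<delta> - \<delta>) * binary_entropy (\<delta> / (del_gamma \<delta> - \<delta>))"

text \<open>The greatest element in the definition of \<^const>\<open>C_del\<close> exists.\<close>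

lemma finite_words: "finite (words n)" and card_words: "card (words n) = 2 ^ n"
  using finite_lists_length_eq[of "UNIV :: bool set" n]
    card_lists_length_eq[of "UNIV :: bool set" n]
  by (simp_all add: words_def)

lemma has_rate_le_1:
  assumes "C \<subseteq> words n" "has_rate n C R" "n > 0"
  shows "R \<le> 1"
proof -
  have "card C \<le> 2 ^ n"
    using card_mono[OF finite_words assms(1)] by (simp only: card_words)
  then have "real (card C) \<le> 2 ^ n"
    by (metis of_nat_le_iff of_nat_numeral of_nat_power)
  then have "2 powr (R * real n) \<le> 2 powr (1 * real n)"
    using assms(2) unfolding has_rate_def by (simp only: mult_1 powr_realpow)
  then show ?thesis using assms(3) by simp
qed

lemma achievable_below_le_1:
  assumes "achievable_below \<delta> K"
  shows "K \<le> 1"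
proof (rule dense_le)
  fix R assume "R < K"
  then obtain L where "\<forall>\<^sub>F n in sequentially. \<exists>C \<subseteq> words n.
      (\<exists>R' \<ge> R. has_rate n C R') \<and> list_decodable_del n \<delta> (L n) C"
    using assms unfolding achievable_below_def by blast
  then have "\<forall>\<^sub>F n in sequentially. R \<le> 1"
    using eventually_gt_at_top[of 0]
    by eventually_elim (meson has_rate_le_1 order_trans)
  then show "R \<le> 1" by simp
qed

lemma achievable_below_0: "achievable_below \<delta> 0"
  unfolding achievable_below_def
proof (intro allI impI)
  fix R :: real assume R: "R < 0"
  have poly: "polynomially_bounded (\<lambda>_. 1)"
    unfolding polynomially_bounded_def by (rule exI[of _ 0]) simp
  have code: "\<exists>C \<subseteq> words n. (\<exists>R' \<ge> R. has_rate n C R') \<and> list_decodable_del n \<delta> 1 C" for n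
  proof (intro exI conjI)
    let ?w = "replicate n False"
    show "{?w} \<subseteq> words n" by (simp add: words_def)
    show "R \<le> 0" using R by simp
    show "has_rate n {?w} 0" by (simp add: has_rate_def)
    have "card (list_at {?w} y) \<le> card {?w}" for y
      by (rule card_mono) (auto simp: list_at_def)
    then show "list_decodable_del n \<delta> 1 {?w}" by (simp add: list_decodable_del_def)
  qed
  show "\<exists>L. polynomially_bounded L \<and> (\<forall>\<^sub>F n in sequentially. \<exists>C \<subseteq> words n.
      (\<exists>R' \<ge> R. has_rate n C R') \<and> list_decodable_del n \<delta> (L n) C)"
    using poly code by (intro exI[of _ "\<lambda>_. 1"] conjI always_eventually allI)
qed

lemma achievable_below_iff: "achievable_below \<delta> K \<longleftrightarrow> K \<le> C_del \<delta>"
proof -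
  define S where "S = {K. achievable_below \<delta> K}"
  have bdd: "bdd_above S" by (rule bdd_aboveI[of _ 1]) (simp add: S_def achievable_below_le_1)
  have ne: "S \<noteq> {}" using achievable_below_0 by (auto simp: S_def)
  have mono: "achievable_below \<delta> K'" if "achievable_below \<delta> K''" "K' \<le> K''" for K' K''
    using that unfolding achievable_below_def by (meson less_le_trans)
  have sup: "achievable_below \<delta> (Sup S)"
    unfolding achievable_below_def
  proof (intro allI impI)
    fix R assume "R < Sup S"
    then obtain K' where "achievable_below \<delta> K'" "R < K'"
      using less_cSup_iff[OF ne bdd] by (auto simp: S_def)
    then show "\<exists>L. polynomially_bounded L \<and> (\<forall>\<^sub>F n in sequentially. \<exists>C \<subseteq> words n.
        (\<exists>R' \<ge> R. has_rate n C R') \<and> list_decodable_del n \<delta> (L n) C)"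
      unfolding achievable_below_def by blast
  qed
  have upper: "K' \<le> Sup S" if "achievable_below \<delta> K'" for K'
    using that by (intro cSup_upper bdd) (simp add: S_def)
  have "C_del \<delta> = Sup S"
    unfolding C_del_def
    by (rule Greatest_equality) (simp_all add: sup upper)
  then show ?thesis by (metis sup mono upper)
qed

end

theory Submission
  imports
    Defs
    "HOL-Probability.Hoeffding"
    "HOL-Real_Asymp.Real_Asymp"
begin

text \<open>
  A word with \<open>r\<close> runs has at least \<open>(r - t) choose t\<close> distinct subsequences obtained by
  \<open>t\<close> deletions. By a Chernoff bound, all but a \<open>2 * 2 powr (- h(\<delta>) n)\<close> fraction of the words
  have at least \<open>\<gamma> n\<close> runs, which is what the choice of \<open>\<gamma>\<close> is for; since the rate
  bound is at least \<open>1 - h(\<delta>)\<close>, at least half of the code consists of such words. Averaging the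
  number of pairs \<open>(c, y)\<close> with \<open>y\<close> a subsequence of \<open>c\<close> over all \<open>y\<close> gives a large list,
  the binomial coefficient being \<open>2 powr ((\<gamma> - \<delta>) h(\<delta> / (\<gamma> - \<delta>)) n)\<close> up to a
  subexponential factor.
\<close>

subsection \<open>Entropy estimates\<close>

text \<open>Up to the factor \<open>ln 2\<close>, this is the logarithm of m^m / (t^t (m - t)^(m -
  t)), the shape in which \<open>binomial_ge\<close> bounds a binomial coefficient.\<close>

lemma scaled_binary_entropy:
  assumes "0 < t" "t < m"
  shows "m * binary_entropy (t / m) = (m * ln m - t * ln t - (m - t) * ln (m - t)) / ln 2"
proof -
  have "1 - t / m = (m - t) / m"
    using assms by (simp add: field_simps)
  then have ln: "ln (t / m) = ln t - ln m" "ln (1 - t / m) = ln (m - t) - ln m"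
    using assms by (simp_all add: ln_div)
  have "m * binary_entropy (t / m) =
      (- t * ln (t / m) - (m - t) * ln (1 - t / m)) / ln 2"
    using assms by (simp add: binary_entropy_def log_def field_simps)
  then show ?thesis
    by (simp only: ln) (simp add: algebra_simps)
qed

lemma binary_entropy_eq:
  "binary_entropy p = (- p * ln p - (1 - p) * ln (1 - p)) / ln 2"
  by (simp add: binary_entropy_def log_def diff_divide_distrib)

lemma binary_entropy_nonneg:
  assumes "0 < p" "p < 1"
  shows "binary_entropy p \<ge> 0"
proof -
  have "p * ln p \<le> 0" "(1 - p) * ln (1 - p) \<le> 0"
    using assms by (simp_all add: mult_nonneg_nonpos)
  then show ?thesis
    by (simp add: binary_entropy_eq)
qed

text \<open>Puts \<open>\<delta> / (del_gamma \<delta> - \<delta>)\<close> strictly between 0 and 1.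
  For \<open>\<delta> < 1/20\<close> the entropy in nats is at most 1/4, and sqrt(1/8) < 2/5, so
  \<open>del_gamma \<delta>\<close> exceeds 1/10.\<close>

lemma two_mult_less_del_gamma:
  assumes "\<delta> \<in> {0<..<1/20}"
  shows "2 * \<delta> < del_gamma \<delta>"
proof -
  \<comment> \<open>The right-hand side is the tangent at 1/20 of the concave function -x ln x. Its
    summand \<open>- \<delta>\<close> cancels against the next bound, leaving
    \<open>\<delta> * ln 20 + 1/20\<close>.\<close>
  have "- \<delta> * ln \<delta> \<le> \<delta> * (ln 20 - 1) + 1/20"
  proof -
    have "ln (1 / (20 * \<delta>)) \<le> 1 / (20 * \<delta>) - 1"
      using assms by (intro ln_le_minus_one) auto
    then have "- ln \<delta> \<le> ln 20 - 1 + 1 / (20 * \<delta>)"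
      using assms by (simp add: ln_div ln_mult)
    then have "\<delta> * - ln \<delta> \<le> \<delta> * (ln 20 - 1 + 1 / (20 * \<delta>))"
      using assms by (intro mult_left_mono) auto
    then show ?thesis
      using assms by (simp add: field_simps)
  qed
  moreover have "- (1 - \<delta>) * ln (1 - \<delta>) \<le> \<delta>"
  proof -
    have "ln (1 / (1 - \<delta>)) \<le> 1 / (1 - \<delta>) - 1"
      using assms by (intro ln_le_minus_one) auto
    then have "- ln (1 - \<delta>) \<le> \<delta> / (1 - \<delta>)"
      using assms by (simp add: ln_div field_simps)
    then show ?thesis
      using assms by (simp add: field_simps)
  qed
  moreover have "\<delta> * ln 20 \<le> 1/20 * 4"
  proof (intro mult_mono)
    have "ln (20::real) \<le> ln (2 ^ 5)"
      by simp
    also have "\<dots> = 5 * ln 2"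
      by (subst ln_realpow) auto
    also have "\<dots> \<le> 4"
      using ln2_le_25_over_36 by simp
    finally show "ln (20::real) \<le> 4" .
  qed (use assms in auto)
  ultimately have "- \<delta> * ln \<delta> - (1 - \<delta>) * ln (1 - \<delta>) \<le> 1/4"
    using assms by (simp add: algebra_simps)
  moreover have "binary_entropy \<delta> * ln 2 = - \<delta> * ln \<delta> - (1 - \<delta>) * ln (1 - \<delta>)"
    by (simp add: binary_entropy_eq)
  ultimately have "binary_entropy \<delta> * ln 2 / 2 < (2/5)\<^sup>2"
    by (simp add: power2_eq_square)
  then have "sqrt (binary_entropy \<delta> * ln 2 / 2) < sqrt ((2/5)\<^sup>2)"
    by (rule real_sqrt_less_mono)
  then show ?thesis
    using assms by (simp add: del_gamma_def)
qed

lemma del_gamma_le: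
  assumes "0 < \<delta>" "\<delta> < 1"
  shows "del_gamma \<delta> \<le> 1 / 2"
  using binary_entropy_nonneg[OF assms] by (simp add: del_gamma_def)

text \<open>
  The exponential form of \<open>2 ^ t * (m choose t) \<le> (2 * m) choose t\<close> with
  \<open>m = (\<gamma> - \<delta>) n \<le> n / 2\<close> and \<open>t = \<delta> n\<close>: first increase \<open>\<gamma> - \<delta>\<close> to \<open>1 / 2\<close>.
\<close>

lemma one_minus_entropy_le_del_rate_bound:
  assumes "\<delta> \<in> {0<..<1/20}"
  shows "1 - binary_entropy \<delta> \<le> del_rate_bound \<delta>"
proof -
  define a where "a = del_gamma \<delta> - \<delta>"
  have a: "\<delta> < a" "a < 1/2"
    using two_mult_less_del_gamma[OF assms] del_gamma_le[of \<delta>] assms by (auto simp: a_def)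
  have d: "0 < \<delta>" "\<delta> < 1/2"
    using assms by auto
  \<comment> \<open>\<open>f a - \<delta> * ln \<delta>\<close> is \<open>ln 2\<close> times
    \<open>a * binary_entropy (\<delta> / a)\<close>; only \<open>f\<close> depends on
    \<open>a\<close>.\<close>
  define f where "f = (\<lambda>x. x * ln x - (x - \<delta>) * ln (x - \<delta>))"
  have "f a \<le> f (1/2)"
  proof (rule DERIV_nonneg_imp_nondecreasing[where f = f])
    show "a \<le> 1/2" using a by simp
    fix x assume x: "a \<le> x" "x \<le> 1/2"
    show "\<exists>y. (f has_real_derivative y) (at x) \<and> 0 \<le> y"
    proof (intro exI[of _ "ln x - ln (x - \<delta>)"] conjI)
      show "(f has_real_derivative (ln x - ln (x - \<delta>))) (at x)"
        unfolding f_def using x a d by (auto intro!: derivative_eq_intros)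
      show "0 \<le> ln x - ln (x - \<delta>)"
        using x a d by simp
    qed
  qed
  moreover have "f (1/2) + \<delta> * ln 2 \<le> - (1 - \<delta>) * ln (1 - \<delta>)"
  proof -
    \<comment> \<open>After expanding \<open>f (1/2)\<close>, the claim reads
      \<open>0 \<le> g \<delta>\<close>, and \<open>g 0 = 0\<close>.\<close>
    define g where "g = (\<lambda>x::real. (1/2 - x) * ln (1 - 2 * x) - (1 - x) * ln (1 - x))"
    have "g 0 \<le> g \<delta>"
    proof (rule DERIV_nonneg_imp_nondecreasing[where f = g])
      show "0 \<le> \<delta>" using d by simp
      fix x assume x: "0 \<le> x" "x \<le> \<delta>"
      show "\<exists>y. (g has_real_derivative y) (at x) \<and> 0 \<le> y"
      proof (intro exI[of _ "ln (1 - x) - ln (1 - 2 * x)"] conjI)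
        show "(g has_real_derivative (ln (1 - x) - ln (1 - 2 * x))) (at x)"
        proof -
          have "((\<lambda>x. (1/2 - x) * ln (1 - 2 * x)) has_real_derivative
              - ln (1 - 2 * x) + (1/2 - x) * (- 2 / (1 - 2 * x))) (at x)"
            using x d by (auto intro!: derivative_eq_intros)
          moreover have "(1/2 - x) * (- 2 / (1 - 2 * x)) = -1"
            using x d by (simp add: field_simps)
          moreover have "((\<lambda>x. (1 - x) * ln (1 - x)) has_real_derivative
              - ln (1 - x) + (1 - x) * (- 1 / (1 - x))) (at x)"
            using x d by (auto intro!: derivative_eq_intros)
          moreover have "(1 - x) * (- 1 / (1 - x)) = -1"
            using x d by (simp add: field_simps)
          ultimately show ?thesis
            unfolding g_def by (auto intro: derivative_eq_intros)
        qed
        show "0 \<le> ln (1 - x) - ln (1 - 2 * x)"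
          using x d by simp
      qed
    qed
    moreover have "ln (1/2 - \<delta>) = ln (1 - 2 * \<delta>) - ln 2"
    proof -
      have "ln (1/2 - \<delta>) = ln ((1 - 2 * \<delta>) / 2)"
        by (simp add: diff_divide_distrib)
      also have "\<dots> = ln (1 - 2 * \<delta>) - ln 2"
        using d ln_div[of "1 - 2 * \<delta>" 2] by simp
      finally show ?thesis .
    qed
    then have "f (1/2) = - (1/2) * ln 2 - (1/2 - \<delta>) * (ln (1 - 2 * \<delta>) - ln 2)"
      by (simp only: f_def) (simp add: ln_div)
    ultimately show ?thesis
      by (simp add: g_def algebra_simps)
  qed
  ultimately have "(\<delta> * ln 2 + (f a - \<delta> * ln \<delta>)) / ln 2 \<le> binary_entropy \<delta>"
    unfolding binary_entropy_eq by (intro divide_right_mono) (simp_all add: algebra_simps)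
  then have "\<delta> + (f a - \<delta> * ln \<delta>) / ln 2 \<le> binary_entropy \<delta>"
    by (simp add: add_divide_distrib)
  moreover have "a * binary_entropy (\<delta> / a) = (f a - \<delta> * ln \<delta>) / ln 2"
    using scaled_binary_entropy[of \<delta> a] d a by (simp add: f_def)
  ultimately show ?thesis
    by (simp add: del_rate_bound_def a_def)
qed

section \<open>The rate bound for small \<open>\<delta>\<close>\<close>

lemma tendsto_del_gamma: "(del_gamma \<longlongrightarrow> 1 / 2) (at_right 0)"
  unfolding del_gamma_def binary_entropy_eq by real_asymp

text \<open>The terms \<open>\<delta> * ln \<delta>\<close> of the two entropies cancel, so the
  difference divided by \<open>\<delta>\<close> is an expression in \<open>q\<close> and
  \<open>ln (a \<delta>)\<close>. Both values of \<open>q\<close> tend to -1 and \<open>a\<close>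
  tends to 1/2, so \<open>- ln 2 - ln (1/2) = 0\<close> remains.\<close>

lemma del_rate_bound_asymp:
  "(\<lambda>\<delta>. del_rate_bound \<delta> - (1 - binary_entropy \<delta>)) \<in> o[at_right 0](\<lambda>\<delta>. \<delta>)"
proof (rule smalloI_tendsto)
  define a where "a \<delta> = del_gamma \<delta> - \<delta>" for \<delta>
  define q where "q x = (1 - x) * ln (1 - x) / x" for x :: real
  have small: "\<forall>\<^sub>F \<delta> in at_right 0. \<delta> \<in> {0<..<1/20::real}"
    by (rule eventually_at_right_real) simp
  have ev: "\<forall>\<^sub>F \<delta> in at_right 0. (q (\<delta> / a \<delta>) - q \<delta> - ln 2 - ln (a \<delta>)) / ln 2 =
      (del_rate_bound \<delta> - (1 - binary_entropy \<delta>)) / \<delta>"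
    using small
  proof eventually_elim
    fix \<delta> :: real assume d: "\<delta> \<in> {0<..<1/20}"
    have a: "\<delta> < a \<delta>"
      using two_mult_less_del_gamma[OF d] by (auto simp: a_def)
    have ln: "ln (\<delta> / a \<delta>) = ln \<delta> - ln (a \<delta>)"
      using d a by (simp add: ln_div)
    have "a \<delta> * binary_entropy (\<delta> / a \<delta>) =
        (- \<delta> * ln (\<delta> / a \<delta>) - \<delta> * q (\<delta> / a \<delta>)) / ln 2"
      using d a by (simp add: binary_entropy_eq q_def field_simps)
    then have "a \<delta> * binary_entropy (\<delta> / a \<delta>) =
        (\<delta> * ln (a \<delta>) - \<delta> * ln \<delta> - \<delta> * q (\<delta> / a \<delta>)) / ln 2"
      by (simp only: ln) (simp add: algebra_simps)
    moreover have "binary_entropy \<delta> = (- \<delta> * ln \<delta> - \<delta> * q \<delta>) / ln 2"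
      using d by (simp add: binary_entropy_eq q_def field_simps)
    ultimately have "del_rate_bound \<delta> - (1 - binary_entropy \<delta>) =
       (\<delta> * q (\<delta> / a \<delta>) - \<delta> * q \<delta> - \<delta> * ln 2 - \<delta> * ln (a \<delta>)) / ln 2"
      unfolding del_rate_bound_def a_def[symmetric] by (simp add: field_simps)
    then show "(q (\<delta> / a \<delta>) - q \<delta> - ln 2 - ln (a \<delta>)) / ln 2 =
        (del_rate_bound \<delta> - (1 - binary_entropy \<delta>)) / \<delta>"
      using d by (simp add: field_simps)
  qed
  have a: "(a \<longlongrightarrow> 1 / 2) (at_right 0)"
    unfolding a_def by (rule tendsto_eq_intros tendsto_del_gamma | simp)+
  have q: "(q \<longlongrightarrow> -1) (at_right 0)"
    unfolding q_def by real_asymp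
  \<comment> \<open>The limit of \<open>q\<close> is one-sided, so
    \<open>\<delta> / a \<delta>\<close> must approach 0 through positive values.\<close>
  have "filterlim (\<lambda>\<delta>. \<delta> / a \<delta>) (at_right 0) (at_right 0)"
    unfolding filterlim_at
  proof
    show "((\<lambda>\<delta>. \<delta> / a \<delta>) \<longlongrightarrow> 0) (at_right 0)"
      using tendsto_divide[OF tendsto_ident_at a] by simp
    have "\<forall>\<^sub>F \<delta> in at_right 0. 0 < a \<delta>"
      by (rule order_tendstoD(1)[OF a]) simp
    with small show "\<forall>\<^sub>F \<delta> in at_right 0. \<delta> / a \<delta> \<in> {0<..} \<and> \<delta> / a \<delta> \<noteq> 0"
      by eventually_elim auto
  qed
  from filterlim_compose[OF q this]
  have "((\<lambda>\<delta>. (q (\<delta> / a \<delta>) - q \<delta> - ln 2 - ln (a \<delta>)) / ln 2) \<longlongrightarrow>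
      (-1 - -1 - ln 2 - ln (1 / 2)) / ln 2) (at_right 0)"
    by (intro tendsto_intros q a) auto
  then have "((\<lambda>\<delta>. (q (\<delta> / a \<delta>) - q \<delta> - ln 2 - ln (a \<delta>)) / ln 2) \<longlongrightarrow> 0) (at_right 0)"
    by (simp add: ln_div)
  then show "((\<lambda>\<delta>. (del_rate_bound \<delta> - (1 - binary_entropy \<delta>)) / \<delta>) \<longlongrightarrow> 0) (at_right 0)"
    by (rule Lim_transform_eventually[OF _ ev])
  show "\<forall>\<^sub>F \<delta>::real in at_right 0. \<delta> \<noteq> 0"
    using small by eventually_elim auto
qed

subsection \<open>Runs, subsequences and binomial coefficients\<close>

abbreviation runs :: "'a list \<Rightarrow> nat" where
  "runs w \<equiv> length (remdups_adj w)"

text \<open>The additive length condition makes the set empty when \<open>t\<close> exceeds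
  \<open>length w\<close>; truncated subtraction would not.\<close>

definition deletions :: "nat \<Rightarrow> 'a list \<Rightarrow> 'a list set" where
  "deletions t w = {y. subseq y w \<and> length y + t = length w}"

lemma finite_deletions: "finite (deletions t w)"
  by (rule finite_subset[of _ "set (subseqs w)"]) (auto simp: deletions_def)

lemma Cons_deletions: "y \<in> deletions t w \<Longrightarrow> a # y \<in> deletions t (a # w)"
  by (auto simp: deletions_def)

lemma Cons_deletions_skip: "y \<in> deletions t w \<Longrightarrow> y \<in> deletions (Suc t) (a # w)"
  by (auto simp: deletions_def)

lemma runs_Cons_le: "runs (a # w) \<le> Suc (runs w)"
  by (cases w) auto

text \<open>
  If the first run has length one, some subsequences start with its symbol and others (obtained by
  deleting it) with the next symbol, which gives Pascal's recurrence; otherwise the first symbol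
  can be kept without losing a run.
\<close>

lemma card_deletions_ge: "(runs w - t) choose t \<le> card (deletions t w)"
proof (induction w arbitrary: t rule: length_induct)
  case (1 v)
  then have IH: "(runs w - s) choose s \<le> card (deletions s w)"
    if "length w < length v" for w :: "'a list" and s
    using that by blast
  have base: "(runs v - t) choose t \<le> card (deletions t v)" if "t = 0"
  proof -
    have "v \<in> deletions 0 v"
      by (auto simp: deletions_def)
    then have "card (deletions 0 v) > 0"
      by (auto simp: card_gt_0_iff finite_deletions)
    then show ?thesis
      using that by simp
  qed
  consider "t = 0" | "t > 0" "length v < 2" | s a b w where "t = Suc s" "v = a # b # w"
    by (cases t; cases v rule: remdups_adj.cases) auto
  then show ?case
  proof cases
    case 1
    then show ?thesis
      by (rule base)
  next
    case 2
    then show ?thesis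
      by (cases v) (auto simp: binomial_eq_0)
  next
    case (3 s a b w)
    note t = \<open>t = Suc s\<close> and v = \<open>v = a # b # w\<close>
    \<comment> \<open>\<open>?A\<close> keeps \<open>a\<close>; \<open>?B\<close> spends one
      deletion on \<open>a\<close> and keeps \<open>b\<close>, so \<open>s\<close> deletions are
      left for \<open>w\<close>.\<close>
    let ?A = "(#) a ` deletions t (b # w)" and ?B = "(#) b ` deletions s w"
    have A: "?A \<subseteq> deletions t (a # b # w)"
      by (auto intro: Cons_deletions)
    have B: "?B \<subseteq> deletions t (a # b # w)"
      unfolding t by (auto intro: Cons_deletions Cons_deletions_skip)
    have IH_A: "(runs (b # w) - t) choose t \<le> card (deletions t (b # w))"
      by (rule IH) (simp add: v)
    have card_A: "card ?A = card (deletions t (b # w))"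
      by (simp add: card_image)
    show ?thesis
    proof (cases "a = b")
      case True
      then have "(runs (a # b # w) - t) choose t \<le> card ?A"
        using IH_A card_A by simp
      also have "\<dots> \<le> card (deletions t (a # b # w))"
        using A by (intro card_mono finite_deletions)
      finally show ?thesis
        by (simp only: v)
    next
      case False
      have runs_w: "runs (a # b # w) \<le> Suc (Suc (runs w))"
        using runs_Cons_le[of b w] False by simp
      show ?thesis
      proof (cases "runs (a # b # w) - t")
        case 0
        then show ?thesis
          using t 0 v by simp
      next
        case (Suc m)
        have "m choose t \<le> card ?A"
        proof -
          have "m = runs (b # w) - t"
            using Suc False by simp
          then show ?thesis
            using IH_A card_A by simp
        qed
        moreover have "m choose s \<le> card ?B"
        proof -
          \<comment> \<open>Dropping \<open>a\<close> and \<open>b\<close> loses at most two runs,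
            but one deletion fewer remains, so the difference falls by at most one.\<close>
          have "m \<le> runs w - s"
            using Suc t runs_w by linarith
          then have "m choose s \<le> (runs w - s) choose s"
            by (rule binomial_right_mono)
          also have "\<dots> \<le> card (deletions s w)"
            by (rule IH) (simp add: v)
          finally show ?thesis
            by (simp add: card_image)
        qed
        ultimately have "(runs (a # b # w) - t) choose t \<le> card ?A + card ?B"
          using Suc t by simp
        also have "\<dots> = card (?A \<union> ?B)"
          using False by (intro card_Un_disjoint[symmetric]) (auto simp: finite_deletions)
        also have "\<dots> \<le> card (deletions t (a # b # w))"
          using A B by (intro card_mono finite_deletions) auto
        finally show ?thesis
          by (simp only: v)
      qed
    qed
  qed
qed

section \<open>A lower bound for binomial coefficients\<close>

text \<open>Consecutive terms t^k / k! have ratio t / (k + 1), so they do not decrease up to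
  \<open>k = t\<close> and decrease afterwards. The proof compares the factors between
  \<open>k\<close> and \<open>t\<close> with \<open>t\<close>.\<close>

lemma power_div_fact_le:
  "real t ^ k / fact k \<le> real t ^ t / fact t"
proof (cases "k \<le> t")
  case True
  have "fact t = (fact k * real (\<Prod>{k+1..t}))"
    using arg_cong[OF fact_eq_fact_times[OF True], of real] by simp
  moreover have "real (\<Prod>{k+1..t}) \<le> real t ^ (t - k)"
    using prod_mono[of "{k+1..t}" real "\<lambda>_. real t"] by simp
  ultimately have "fact t \<le> fact k * real t ^ (t - k)"
    by simp
  then have "real t ^ k * fact t \<le> real t ^ k * (fact k * real t ^ (t - k))"
    by (intro mult_left_mono) auto
  also have "\<dots> = real t ^ t * fact k"
    using True by (simp flip: power_add)
  finally show ?thesis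
    by (simp add: field_simps)
next
  case False
  then have tk: "t \<le> k" by simp
  have "fact k = (fact t * real (\<Prod>{t+1..k}))"
    using arg_cong[OF fact_eq_fact_times[OF tk], of real] by simp
  moreover have "real t ^ (k - t) \<le> real (\<Prod>{t+1..k})"
    using prod_mono[of "{t+1..k}" "\<lambda>_. real t" real] by simp
  ultimately have "fact t * real t ^ (k - t) \<le> fact k"
    by simp
  then have "real t ^ t * (fact t * real t ^ (k - t)) \<le> real t ^ t * fact k"
    by (intro mult_left_mono) auto
  moreover have "real t ^ t * (fact t * real t ^ (k - t)) = real t ^ k * fact t"
    using tk by (simp flip: power_add)
  ultimately show ?thesis
    by (simp add: field_simps)
qed

text \<open>
  The term \<open>k = t\<close> is the largest one in the expansion of \<open>(t + (m - t)) ^ m\<close>.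
\<close>

lemma binomial_ge:
  assumes "t \<le> m"
  shows "real m ^ m \<le> real (Suc m) * (real (m choose t) * real t ^ t * real (m - t) ^ (m - t))"
proof -
  define T where "T = real (m choose t) * real t ^ t * real (m - t) ^ (m - t)"
  have "real (m choose k) * real t ^ k * real (m - t) ^ (m - k) \<le> T" if "k \<le> m" for k
  proof -
    \<comment> \<open>Splitting the binomial coefficient into factorials gives two independent
      factors, each maximal at \<open>k = t\<close> by \<open>power_div_fact_le\<close>.\<close>
    have "real (m choose k) * real t ^ k * real (m - t) ^ (m - k) =
        fact m * ((real t ^ k / fact k) * (real (m - t) ^ (m - k) / fact (m - k)))"
      by (simp add: binomial_fact[OF that])
    also have "\<dots> \<le> fact m * ((real t ^ t / fact t) * (real (m - t) ^ (m - t) / fact (m - t)))"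
      by (intro mult_left_mono mult_mono power_div_fact_le) auto
    also have "\<dots> = T"
      by (simp add: binomial_fact[OF assms] T_def)
    finally show ?thesis .
  qed
  then have "(\<Sum>k\<le>m. real (m choose k) * real t ^ k * real (m - t) ^ (m - k)) \<le> (\<Sum>k\<le>m. T)"
    by (intro sum_mono) auto
  moreover have "real m ^ m = (\<Sum>k\<le>m. real (m choose k) * real t ^ k * real (m - t) ^ (m - k))"
    using binomial_ring[of "real t" "real (m - t)" m] assms by simp
  ultimately show ?thesis
    by (simp add: T_def)
qed

section \<open>Words with few runs\<close>

lemma sum_words_Suc:
  "(\<Sum>w\<in>words (Suc n). f w) = (\<Sum>w\<in>words n. f (True # w) + f (False # w))"
proof -
  have "words (Suc n) = (#) True ` words n \<union> (#) False ` words n"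
    by (auto simp: words_def length_Suc_conv image_iff)
  then have "(\<Sum>w\<in>words (Suc n). f w) =
      (\<Sum>w\<in>(#) True ` words n. f w) + (\<Sum>w\<in>(#) False ` words n. f w)"
    by (simp only:) (rule sum.union_disjoint, auto simp: finite_words)
  then show ?thesis
    by (simp add: sum.reindex sum.distrib)
qed

text \<open>The generating function of the number of runs: the first symbol is free and opens a run,
  and each further symbol either continues the current run (factor 1) or opens a new one (factor
  \<open>z\<close>).\<close>

lemma sum_power_runs:
  fixes z :: "'a :: comm_semiring_1"
  shows "(\<Sum>w\<in>words (Suc n). z ^ runs w) = 2 * z * (1 + z) ^ n"
proof (induction n)
  case 0
  have "words 0 = {[]}"
    by (auto simp: words_def)
  then show ?case
    by (subst sum_words_Suc) (simp flip: mult_2)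
next
  case (Suc n)
  have "z ^ runs (True # w) + z ^ runs (False # w) = (1 + z) * z ^ runs w"
    if w: "w \<in> words (Suc n)" for w
  proof -
    obtain b v where "w = b # v"
      using w by (cases w) (auto simp: words_def)
    then show ?thesis
      by (cases b) (simp_all add: algebra_simps)
  qed
  then have "(\<Sum>w\<in>words (Suc (Suc n)). z ^ runs w) = (1 + z) * (\<Sum>w\<in>words (Suc n). z ^ runs w)"
    by (subst sum_words_Suc) (simp add: sum_distrib_left)
  then show ?case
    using Suc by (simp add: algebra_simps)
qed

text \<open>Chernoff's method: weight each word by \<open>z ^ runs w\<close> with
  \<open>z = exp (- s)\<close>, and evaluate the total weight by
  \<open>sum_power_runs\<close>.\<close>

lemma card_few_runs_le:
  assumes "g \<le> 1 / 2"
  shows "real (card {w \<in> words n. real (runs w) < g * real n})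
    \<le> 2 * 2 ^ n * exp (- 2 * (1 / 2 - g)\<^sup>2 * real n)"
proof (cases n)
  case 0
  then show ?thesis by simp
next
  case (Suc k)
  define u where "u = 1 / 2 - g"
  \<comment> \<open>The final exponent per symbol is \<open>s\<^sup>2 / 8 - s * u\<close>, minimal
    at \<open>s = 4 * u\<close> with value \<open>- 2 * u\<^sup>2\<close>.\<close>
  define s where "s = 4 * u"
  define z where "z = exp (- s)"
  define F where "F = {w \<in> words n. real (runs w) < g * real n}"
  have s: "s \<ge> 0"
    using assms by (simp add: s_def u_def)
  have "exp (- s * g * n) \<le> z ^ runs w" if "w \<in> F" for w
  proof -
    have "s * real (runs w) \<le> s * (g * n)"
      using that s by (intro mult_left_mono) (auto simp: F_def)
    then show ?thesis
      by (simp add: z_def mult_ac flip: exp_of_nat_mult)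
  qed
  then have "real (card F) * exp (- s * g * n) \<le> (\<Sum>w\<in>F. z ^ runs w)"
    by (rule sum_bounded_below)
  also have "\<dots> \<le> (\<Sum>w\<in>words n. z ^ runs w)"
    by (intro sum_mono2) (auto simp: F_def finite_words z_def)
  also have "\<dots> = 2 * z * (1 + z) ^ k"
    unfolding Suc by (rule sum_power_runs)
  also have "\<dots> \<le> 2 * (1 + z) * (1 + z) ^ k"
    by (intro mult_right_mono) (auto simp: z_def)
  also have "\<dots> = 2 * (1 + z) ^ n"
    by (simp add: Suc)
  \<comment> \<open>Hoeffding's estimate for a fair bit, applied to the nonnegative parameter
    \<open>s\<close>; multiplying by \<open>exp (- s)\<close> turns \<open>1 + exp s\<close> into
    \<open>1 + z\<close>.\<close>
  also have "1 + z \<le> 2 * exp (- s / 2 + s\<^sup>2 / 8)"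
  proof -
    have "exp s > 0" by simp
    then have "1 + exp s > 0" by linarith
    have "- s / 2 + ln ((1 + exp s) / 2) \<le> s\<^sup>2 / 8"
      using Hoeffdings_lemma_aux[of s "1/2"] s by (simp add: field_simps)
    then have "exp (ln ((1 + exp s) / 2)) \<le> exp (s / 2 + s\<^sup>2 / 8)"
      by simp
    then have "1 + exp s \<le> 2 * exp (s / 2 + s\<^sup>2 / 8)"
      using \<open>1 + exp s > 0\<close> by simp
    then have "(1 + exp s) * exp (- s) \<le> 2 * exp (s / 2 + s\<^sup>2 / 8) * exp (- s)"
      by (rule mult_right_mono) simp
    moreover have "exp (s / 2 + s\<^sup>2 / 8) * exp (- s) = exp (- s / 2 + s\<^sup>2 / 8)"
      by (simp flip: exp_add)
    moreover have "(1 + exp s) * exp (- s) = 1 + z"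
      by (simp add: z_def ring_distribs flip: exp_add)
    ultimately show ?thesis
      by (simp add: mult.assoc)
  qed
  then have "2 * (1 + z) ^ n \<le> 2 * (2 * exp (- s / 2 + s\<^sup>2 / 8)) ^ n"
    by (intro mult_left_mono power_mono) (auto simp: z_def)
  finally have "real (card F) * exp (- s * g * n) * exp (s * g * n) \<le>
      2 * (2 * exp (- s / 2 + s\<^sup>2 / 8)) ^ n * exp (s * g * n)"
    by (intro mult_right_mono) auto
  also have "\<dots> = 2 * 2 ^ n * exp (n * (- s / 2 + s\<^sup>2 / 8) + s * g * n)"
    by (simp add: power_mult_distrib exp_add exp_of_nat_mult)
  also have "n * (- s / 2 + s\<^sup>2 / 8) + s * g * n = - 2 * u\<^sup>2 * n"
    by (simp add: s_def u_def power2_eq_square field_simps)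
  finally show ?thesis
    by (simp add: F_def u_def mult.assoc flip: exp_add)
qed

text \<open>\<open>del_gamma\<close> solves
  \<open>2 * (1/2 - g)\<^sup>2 = binary_entropy \<delta> * ln 2\<close> for \<open>g\<close>, which
  turns the Chernoff factor into a power of 2.\<close>

lemma card_few_runs_del_gamma_le:
  assumes "0 < \<delta>" "\<delta> < 1"
  shows "real (card {w \<in> words n. real (runs w) < del_gamma \<delta> * real n})
    \<le> 2 * 2 powr ((1 - binary_entropy \<delta>) * real n)"
proof -
  have "(1 / 2 - del_gamma \<delta>)\<^sup>2 = binary_entropy \<delta> * ln 2 / 2"
    using binary_entropy_nonneg[OF assms] by (simp add: del_gamma_def)
  then have "exp (- 2 * (1 / 2 - del_gamma \<delta>)\<^sup>2 * real n) = 2 powr (- binary_entropy \<delta> * n)"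
    by (simp add: powr_def mult_ac)
  moreover have "2 ^ n * 2 powr (- binary_entropy \<delta> * n) = 2 powr ((1 - binary_entropy \<delta>) * n)"
    by (simp add: algebra_simps powr_diff powr_minus powr_realpow divide_simps)
  ultimately show ?thesis
    using card_few_runs_le[OF del_gamma_le[OF assms], of n] by (simp add: mult.assoc)
qed

section \<open>Exponential growth of binomial coefficients\<close>

text \<open>Take logarithms in \<open>binomial_ge\<close> and divide by \<open>n\<close>; the factor
  \<open>Suc m\<close> contributes a vanishing error. Assuming only limiting proportions leaves room
  for rounding.\<close>

lemma eventually_binomial_ge:
  fixes m t :: "nat \<Rightarrow> nat"
  assumes m: "(\<lambda>n. real (m n) / real n) \<longlonglongrightarrow> a" and t: "(\<lambda>n. real (t n) / real n) \<longlonglongrightarrow> d"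
  assumes "0 < d" "d < a" "e > 0"
  shows "\<forall>\<^sub>F n in sequentially.
    2 powr (real n * (a * binary_entropy (d / a) - e)) \<le> real (m n choose t n)"
proof -
  define \<mu> where "\<mu> n = real (m n) / real n" for n
  define \<tau> where "\<tau> n = real (t n) / real n" for n
  \<comment> \<open>The last bracket is ln(m + 1) / n, split so that both summands visibly tend to
    0.\<close>
  define G where "G n = \<mu> n * ln (\<mu> n) - \<tau> n * ln (\<tau> n) - (\<mu> n - \<tau> n) * ln (\<mu> n - \<tau> n)
      - (ln (\<mu> n + 1 / n) * (1 / n) + ln n / n)" for n
  have inv: "(\<lambda>n. 1 / real n) \<longlonglongrightarrow> 0" and ln: "(\<lambda>n. ln (real n) / real n) \<longlonglongrightarrow> 0"
    by real_asymp+
  have lim: "\<mu> \<longlonglongrightarrow> a" "\<tau> \<longlonglongrightarrow> d"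
    using m t by (simp_all add: \<mu>_def[abs_def] \<tau>_def[abs_def])
  have "G \<longlonglongrightarrow> a * ln a - d * ln d - (a - d) * ln (a - d) - (ln (a + 0) * 0 + 0)"
    unfolding G_def[abs_def] using assms by (intro tendsto_intros lim inv ln) auto
  moreover have "(a * binary_entropy (d / a) - e) * ln 2 < a * ln a - d * ln d - (a - d) * ln (a - d)"
  proof -
    have "a * binary_entropy (d / a) * ln 2 = a * ln a - d * ln d - (a - d) * ln (a - d)"
      using scaled_binary_entropy[of d a] assms by simp
    then show ?thesis
      using \<open>e > 0\<close> by (simp only: left_diff_distrib) simp
  qed
  ultimately have G: "\<forall>\<^sub>F n in sequentially. (a * binary_entropy (d / a) - e) * ln 2 < G n"
    by (intro order_tendstoD(1)) auto
  have "\<forall>\<^sub>F n in sequentially. 0 < \<tau> n"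
    by (rule order_tendstoD(1)[OF lim(2)]) fact
  moreover have "\<forall>\<^sub>F n in sequentially. 0 < \<mu> n - \<tau> n"
    using assms by (intro order_tendstoD(1)[OF tendsto_diff[OF lim]]) simp
  ultimately show ?thesis
    using G eventually_gt_at_top[of 0]
  proof eventually_elim
    fix n assume *: "0 < \<tau> n" "0 < \<mu> n - \<tau> n"
      "(a * binary_entropy (d / a) - e) * ln 2 < G n" "0 < n"
    define N where "N = real (m n choose t n)"
    have mt: "0 < t n" "t n < m n"
      using * by (auto simp: \<mu>_def \<tau>_def field_simps)
    then have "N > 0"
      by (simp add: N_def)
    have "ln (real (m n) ^ m n) \<le>
        ln (real (Suc (m n)) * (N * real (t n) ^ t n * real (m n - t n) ^ (m n - t n)))"
      using binomial_ge[of "t n" "m n"] mt by (simp add: N_def)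
    then have le: "m n * ln (m n) \<le>
        ln (real (m n) + 1) + ln N + t n * ln (t n) + (real (m n) - t n) * ln (real (m n) - t n)"
      using mt \<open>N > 0\<close> by (simp add: ln_mult ln_realpow of_nat_diff add_ac)
    have eqs: "real (m n) = n * \<mu> n" "real (t n) = n * \<tau> n"
      "real (m n) - t n = n * (\<mu> n - \<tau> n)" "real (m n) + 1 = n * (\<mu> n + 1 / n)"
      using \<open>0 < n\<close> by (simp_all add: \<mu>_def \<tau>_def field_simps)
    have pos: "0 < \<mu> n" "0 < \<mu> n + 1 / n"
      using * by (auto intro: add_pos_nonneg)
    have scale: "ln y = ln n + ln x" if "y = n * x" "0 < x" for x y :: real
      using that \<open>0 < n\<close> by (simp add: ln_mult)
    have lns: "ln (m n) = ln n + ln (\<mu> n)" "ln (t n) = ln n + ln (\<tau> n)"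
      "ln (real (m n) - t n) = ln n + ln (\<mu> n - \<tau> n)" "ln (real (m n) + 1) = ln n + ln (\<mu> n + 1 / n)"
      by (rule scale[OF eqs(1) pos(1)] scale[OF eqs(2) *(1)] scale[OF eqs(3) *(2)]
          scale[OF eqs(4) pos(2)])+
    have "n * G n = n * \<mu> n * ln (\<mu> n) - n * \<tau> n * ln (\<tau> n) - n * (\<mu> n - \<tau> n) * ln (\<mu> n - \<tau> n)
      - (ln (\<mu> n + 1 / n) + ln n)"
      using \<open>0 < n\<close> by (simp add: G_def algebra_simps)
    \<comment> \<open>The multiples of \<open>ln n\<close> coming from \<open>m\<close>,
      \<open>t\<close> and \<open>m - t\<close> cancel.\<close>
    also have "\<dots> = m n * ln (m n) - t n * ln (t n)
        - (real (m n) - t n) * ln (real (m n) - t n) - ln (real (m n) + 1)"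
      unfolding lns by (simp add: eqs[symmetric] algebra_simps)
    also have "\<dots> \<le> ln N"
      using le by linarith
    finally have "n * ((a * binary_entropy (d / a) - e) * ln 2) \<le> ln N"
      using *(3) by (meson less_imp_le mult_left_mono of_nat_0_le_iff order_trans)
    then have "exp (n * ((a * binary_entropy (d / a) - e) * ln 2)) \<le> N"
      using \<open>N > 0\<close> by (metis exp_le_cancel_iff exp_ln)
    then show "2 powr (real n * (a * binary_entropy (d / a) - e)) \<le> real (m n choose t n)"
      by (simp add: powr_def N_def mult_ac)
  qed
qed

section \<open>Averaging over received words\<close>

lemma ex_large_list:
  assumes "C \<subseteq> words n" "t \<le> n"
  shows "\<exists>y\<in>words (n - t).
    card {c \<in> C. g \<le> runs c} * ((g - t) choose t) \<le> 2 ^ (n - t) * card (list_at C y)"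
proof (rule ccontr)
  define D where "D = {c \<in> C. g \<le> runs c}"
  define K where "K = (g - t) choose t"
  assume "\<not> ?thesis"
  then have less: "2 ^ (n - t) * card (list_at C y) < card D * K" if "y \<in> words (n - t)" for y
    using that by (auto simp: D_def K_def not_le)
  have fin: "finite C"
    using assms(1) finite_words finite_subset by blast
  then have "finite D"
    by (simp add: D_def)
  have "replicate (n - t) True \<in> words (n - t)"
    by (simp add: words_def)
  \<comment> \<open>Count the pairs of a codeword in \<open>D\<close> and a received word by
    codeword, then by received word. The chain starts and ends at
    \<open>2 ^ (n - t) * (card D * K)\<close>, with one strict step.\<close>
  have "2 ^ (n - t) * (card D * K) \<le> 2 ^ (n - t) * (\<Sum>c\<in>D. card (deletions t c))"
  proof (intro mult_left_mono sum_bounded_below[of D K, simplified])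
    fix c assume "c \<in> D"
    then have "K \<le> (runs c - t) choose t"
      unfolding K_def D_def by (intro binomial_right_mono) auto
    then show "K \<le> card (deletions t c)"
      using card_deletions_ge[of c t] by linarith
  qed simp
  also have "(\<Sum>c\<in>D. card (deletions t c)) = (\<Sum>c\<in>D. card {y \<in> words (n - t). subseq y c})"
  proof (intro sum.cong refl arg_cong[of _ _ card])
    fix c assume "c \<in> D"
    then have "length c = n"
      using assms(1) by (auto simp: D_def words_def)
    then show "deletions t c = {y \<in> words (n - t). subseq y c}"
      using assms(2) by (auto simp: deletions_def words_def)
  qed
  also have "\<dots> = (\<Sum>y\<in>words (n - t). card {c \<in> D. subseq y c})"
    by (rule sum_multicount_gen) (use \<open>finite D\<close> finite_words in auto)
  also have "\<dots> \<le> (\<Sum>y\<in>words (n - t). card (list_at C y))"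
    by (intro sum_mono card_mono) (auto simp: D_def list_at_def fin)
  also have "2 ^ (n - t) * \<dots> = (\<Sum>y\<in>words (n - t). 2 ^ (n - t) * card (list_at C y))"
    by (simp add: sum_distrib_left)
  also have "\<dots> < (\<Sum>y\<in>words (n - t). card D * K)"
    using \<open>replicate (n - t) True \<in> _\<close> less by (intro sum_strict_mono finite_words) auto
  finally show False
    by (simp add: card_words)
qed

subsection \<open>Large lists\<close>

text \<open>Of the surplus \<open>\<epsilon> * n\<close> in the exponent, rounding \<open>t\<close>
  and the binomial estimate cost \<open>\<epsilon> * n / 8\<close> each, and halving the code costs
  1, at most \<open>\<epsilon> * n / 4\<close> once \<open>4 \<le> \<epsilon> * n\<close>. Half the
  surplus remains. The threshold for \<open>n\<close> is fixed before \<open>R\<close> and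
  \<open>C\<close>.\<close>

lemma eventually_ex_large_list:
  assumes \<delta>: "\<delta> \<in> {0<..<1/20}" and "\<epsilon> > 0"
  shows "\<forall>\<^sub>F n in sequentially. \<forall>R C.
    C \<subseteq> words n \<and> has_rate n C R \<and> R \<ge> del_rate_bound \<delta> + \<epsilon> \<longrightarrow>
    (\<exists>y \<in> words (received_length \<delta> n). real (card (list_at C y)) \<ge> 2 powr (1/2 * \<epsilon> * real n))"
proof -
  define g where "g = del_gamma \<delta>"
  define t where "t n = nat \<lfloor>\<delta> * real n\<rfloor>" for n :: nat
  \<comment> \<open>Rounding up makes \<open>r n \<le> runs c\<close> equivalent to
    \<open>g * n \<le> runs c\<close>, so that \<open>D\<close> and \<open>E\<close> below cover
    \<open>C\<close>.\<close>
  define r where "r n = nat \<lceil>g * real n\<rceil>" for n :: nat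
  have g: "2 * \<delta> < g" "0 < \<delta>" "\<delta> < 1"
    using two_mult_less_del_gamma[OF \<delta>] \<delta> by (auto simp: g_def)
  have t: "(\<lambda>n. real (t n) / real n) \<longlonglongrightarrow> \<delta>"
    unfolding t_def using g by real_asymp
  have r: "(\<lambda>n. real (r n) / real n) \<longlonglongrightarrow> g"
    unfolding r_def using g by real_asymp
  have t_le_r: "t n \<le> r n" for n
    unfolding t_def r_def using g
    by (intro nat_mono)
      (smt (verit, best) floor_le_ceiling floor_mono mult_right_mono of_nat_0_le_iff)
  have t_le: "t n \<le> n" for n
  proof -
    have "\<delta> * real n \<le> 1 * real n"
      using g by (intro mult_right_mono) auto
    then show ?thesis
      by (simp add: t_def nat_le_iff floor_le_iff)
  qed
  have m: "(\<lambda>n. real (r n - t n) / real n) \<longlonglongrightarrow> g - \<delta>"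
    using tendsto_diff[OF r t] by (simp add: of_nat_diff t_le_r diff_divide_distrib)
  have "\<forall>\<^sub>F n in sequentially. \<delta> - \<epsilon> / 8 < real (t n) / real n"
    using \<open>\<epsilon> > 0\<close> by (intro order_tendstoD(1)[OF t]) simp
  moreover have "\<forall>\<^sub>F n in sequentially. 4 \<le> \<epsilon> * real n"
    using \<open>\<epsilon> > 0\<close> by real_asymp
  moreover have "\<forall>\<^sub>F n in sequentially.
      2 powr (real n * ((g - \<delta>) * binary_entropy (\<delta> / (g - \<delta>)) - \<epsilon> / 8)) \<le> real ((r n - t n) choose t n)"
    using g \<open>\<epsilon> > 0\<close> by (intro eventually_binomial_ge m t) auto
  ultimately show ?thesis
    using eventually_gt_at_top[of 0]
  proof eventually_elim
    case (elim n)
    define B where "B = del_rate_bound \<delta>"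
    define K where "K = real ((r n - t n) choose t n)"
    \<comment> \<open>By definition of \<open>del_rate_bound\<close>,
      \<open>1 - \<delta> - B\<close> is exactly the binomial exponent.\<close>
    have K: "2 powr (real n * (1 - \<delta> - B - \<epsilon> / 8)) \<le> K"
      using elim(3) by (simp add: K_def B_def del_rate_bound_def g_def)
    show ?case
    proof (intro allI impI; elim conjE)
      fix R C assume C: "C \<subseteq> words n" and rate: "has_rate n C R" and R: "R \<ge> del_rate_bound \<delta> + \<epsilon>"
      define D where "D = {c \<in> C. r n \<le> runs c}"
      define E where "E = {w \<in> words n. real (runs w) < del_gamma \<delta> * real n}"
      have "finite C"
        using C finite_words finite_subset by blast
      have "real (card E) \<le> 2 * 2 powr ((1 - binary_entropy \<delta>) * real n)"
        using card_few_runs_del_gamma_le[of \<delta> n] g by (simp add: E_def)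
      also have "\<dots> = 2 powr (1 + (1 - binary_entropy \<delta>) * real n)"
        by (simp add: powr_add)
      \<comment> \<open>Words with few runs make up at most half of the code, since \<open>R\<close>
        exceeds \<open>1 - binary_entropy \<delta>\<close> by at least \<open>\<epsilon>\<close> and
        \<open>\<epsilon> * n \<ge> 2\<close>.\<close>
      also have "\<dots> \<le> 2 powr (R * real n - 1)"
      proof (rule powr_mono)
        have "(1 - binary_entropy \<delta> + \<epsilon>) * real n \<le> R * real n"
          using one_minus_entropy_le_del_rate_bound[OF \<delta>] R by (intro mult_right_mono) auto
        then show "1 + (1 - binary_entropy \<delta>) * real n \<le> R * real n - 1"
          using elim(2) by (simp add: distrib_right)
      qed simp
      finally have "real (card E) \<le> 2 powr (R * real n) / 2"
        by (simp add: powr_diff)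
      moreover have "card C \<le> card (D \<union> E)"
        using C \<open>finite C\<close> finite_words[of n]
        by (intro card_mono) (auto simp: D_def E_def r_def g_def nat_le_iff ceiling_le_iff)
      then have "real (card C) \<le> real (card D) + real (card E)"
        using card_Un_le[of D E] by linarith
      ultimately have "2 powr (R * real n) / 2 \<le> real (card D)"
        using rate by (simp add: has_rate_def)
      then have D: "2 powr (R * real n - 1) \<le> real (card D)"
        by (simp add: powr_diff)
      obtain y where y: "y \<in> words (n - t n)"
        and "card D * ((r n - t n) choose t n) \<le> 2 ^ (n - t n) * card (list_at C y)"
        using ex_large_list[OF C t_le, of "r n"] unfolding D_def by blast
      then have le: "real (card D) * K \<le> 2 ^ (n - t n) * real (card (list_at C y))"
        unfolding K_def by (metis of_nat_le_iff of_nat_mult of_nat_numeral of_nat_power)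
      have "2 powr (real n - real (t n)) * 2 powr (1/2 * \<epsilon> * real n) =
          2 powr (real n - real (t n) + 1/2 * \<epsilon> * real n)"
        by (simp add: powr_add)
      also have "\<dots> \<le> 2 powr ((R * real n - 1) + real n * (1 - \<delta> - B - \<epsilon> / 8))"
      proof (rule powr_mono)
        have "(\<delta> - \<epsilon> / 8) * real n \<le> real (t n)"
          using elim(1,4) by (simp add: field_simps)
        moreover have "(B + \<epsilon>) * real n \<le> R * real n"
          using R by (intro mult_right_mono) (auto simp: B_def)
        ultimately show "real n - real (t n) + 1/2 * \<epsilon> * real n
            \<le> (R * real n - 1) + real n * (1 - \<delta> - B - \<epsilon> / 8)"
          using elim(2) by (simp add: algebra_simps)
      qed simp
      also have "\<dots> = 2 powr (R * real n - 1) * 2 powr (real n * (1 - \<delta> - B - \<epsilon> / 8))"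
        by (rule powr_add)
      also have "\<dots> \<le> real (card D) * K"
        by (intro mult_mono D K) auto
      also have "\<dots> \<le> 2 powr (real n - real (t n)) * real (card (list_at C y))"
        using le t_le[of n] by (simp add: of_nat_diff flip: powr_realpow)
      finally have "2 powr (1/2 * \<epsilon> * real n) \<le> real (card (list_at C y))"
        by simp
      with y show "\<exists>y \<in> words (received_length \<delta> n).
          2 powr (1/2 * \<epsilon> * real n) \<le> real (card (list_at C y))"
        unfolding received_length_def t_def by blast
    qed
  qed
qed

text \<open>At a rate above the bound by a fixed amount the lists grow exponentially, which no
  polynomial list size permits.\<close>

lemma C_del_le_del_rate_bound:
  assumes \<delta>: "\<delta> \<in> {0<..<1/20}"
  shows "C_del \<delta> \<le> del_rate_bound \<delta>"
proof (rule ccontr)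
  assume less: "\<not> C_del \<delta> \<le> del_rate_bound \<delta>"
  \<comment> \<open>Half the gap keeps \<open>del_rate_bound \<delta> + \<epsilon>\<close> strictly
    below the capacity, hence achievable.\<close>
  define \<epsilon> where "\<epsilon> = (C_del \<delta> - del_rate_bound \<delta>) / 2"
  have \<epsilon>: "\<epsilon> > 0" "del_rate_bound \<delta> + \<epsilon> < C_del \<delta>"
    using less by (auto simp: \<epsilon>_def field_simps)
  have "achievable_below \<delta> (C_del \<delta>)"
    by (simp add: achievable_below_iff)
  then obtain L where "polynomially_bounded L"
    and L: "\<forall>\<^sub>F n in sequentially. \<exists>C \<subseteq> words n.
      (\<exists>R' \<ge> del_rate_bound \<delta> + \<epsilon>. has_rate n C R') \<and> list_decodable_del n \<delta> (L n) C"
    using \<epsilon>(2) unfolding achievable_below_def by blast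
  then obtain k where "(\<lambda>n. real (L n)) \<in> O(\<lambda>n. real n ^ k)"
    by (auto simp: polynomially_bounded_def)
  also have "(\<lambda>n. real n ^ k) \<in> o(\<lambda>n. 2 powr (1/2 * \<epsilon> * real n))"
    using \<epsilon>(1) by real_asymp
  \<comment> \<open>The factor 1/2 makes the clash strict: a positive number would be at most half
    of itself.\<close>
  finally have "\<forall>\<^sub>F n in sequentially. norm (real (L n)) \<le> 1/2 * norm (2 powr (1/2 * \<epsilon> * real n))"
    by (rule landau_o.smallD) simp
  with L eventually_ex_large_list[OF \<delta> \<epsilon>(1)] have "\<forall>\<^sub>F n :: nat in sequentially. False"
  proof eventually_elim
    case (elim n)
    then obtain C R where "C \<subseteq> words n" "R \<ge> del_rate_bound \<delta> + \<epsilon>" "has_rate n C R"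
      and dec: "list_decodable_del n \<delta> (L n) C"
      by blast
    then obtain y where "y \<in> words (received_length \<delta> n)"
      and "2 powr (1/2 * \<epsilon> * real n) \<le> real (card (list_at C y))"
      using elim(2) by blast
    moreover from this(1) have "card (list_at C y) \<le> L n"
      using dec by (simp add: list_decodable_del_def)
    ultimately have "2 powr (1/2 * \<epsilon> * real n) \<le> real (L n)"
      by (meson of_nat_mono order_trans)
    also have "\<dots> \<le> 1/2 * 2 powr (1/2 * \<epsilon> * real n)"
      using elim(3) by simp
    finally show False
      by simp
  qed
  then show False
    by simp
qed

theorem theorem1p3:
  shows "(\<exists>c::real. c > 0 \<and>
      (\<forall>\<epsilon>::real. \<forall>\<delta>::real. \<epsilon> > 0 \<and> \<delta> \<in> {0<..<1/20} \<longrightarrow>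
        (\<forall>\<^sub>F n in sequentially. \<forall>(R::real) C.
           C \<subseteq> words n \<and> has_rate n C R \<and> R \<ge> del_rate_bound \<delta> + \<epsilon> \<longrightarrow>
           (\<exists>y \<in> words (received_length \<delta> n).
              real (card (list_at C y)) \<ge> 2 powr (c * \<epsilon> * real n)))))
    \<and> (\<forall>\<delta>::real. \<delta> \<in> {0<..<1/20} \<longrightarrow> C_del \<delta> \<le> del_rate_bound \<delta>)
    \<and> (\<lambda>\<delta>. del_rate_bound \<delta> - (1 - binary_entropy \<delta>)) \<in> o[at_right 0](\<lambda>\<delta>. \<delta>)"
\<comment> \<open>The constant 1/2 is the share of \<open>\<epsilon>\<close> left over in
  \<open>eventually_ex_large_list\<close>, the same for all \<open>\<epsilon>\<close> and
  \<open>\<delta>\<close>.\<close>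
proof (intro conjI exI[of _ "1/2"] allI impI)
  show "0 < (1/2 :: real)"
    by simp
next
  fix \<epsilon> \<delta> :: real
  assume "\<epsilon> > 0 \<and> \<delta> \<in> {0<..<1/20}"
  then show "\<forall>\<^sub>F n in sequentially. \<forall>(R::real) C.
      C \<subseteq> words n \<and> has_rate n C R \<and> R \<ge> del_rate_bound \<delta> + \<epsilon> \<longrightarrow>
      (\<exists>y \<in> words (received_length \<delta> n).
        real (card (list_at C y)) \<ge> 2 powr (1/2 * \<epsilon> * real n))"
    by (intro eventually_ex_large_list) auto
next
  fix \<delta> :: real
  assume "\<delta> \<in> {0<..<1/20}"
  then show "C_del \<delta> \<le> del_rate_bound \<delta>"
    by (rule C_del_le_del_rate_bound)
qed (rule del_rate_bound_asymp)

end
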